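(* Let $X$ be a Hausdorff topological space and let $E$ be a locally convex space continuously included in $(C(X),\tau_p)$. Let $w:X\to\mathbb{C}$ and $\varphi:X\to X$ be continuous and such that the weighted composition operator $C_{w,\varphi}:E\to E$, $f\mapsto w\cdot(f\circ\varphi)$, is well defined and continuous. If any of the following conditions holds, then $C_{w,\varphi}:E\to E$ is not $\tau_p$-supercyclic: (i) $\varphi$ has two fixed points $z_1,z_2$ such that the evaluations $\{\delta_{z_1},\delta_{z_2}\}\subseteq E'$ are linearly independent. (ii) There exists an orbit $\{\varphi^n(z_1): n=0,1,\dots\}$, $z_1\in X$, non-constant and convergent to an element $z_0\in X$ satisfying $\delta_{z_0}\neq 0$, and with $\{\delta_{z_1},\delta_{\varphi(z_1)}\}$ linearly independent in $E'$. (iii) $X$ is compact and $\varphi$ has a periodic (not fixed) point $z_1$ such that $\{\delta_{z_1},\delta_{\varphi(z_1)}\}$ are linearly independent in $E'$. (iv) $X$ is compact, $\varphi$ has a fixed point $z_2$ such that $|w(z)|\le|w(z_2)|$ for all $z\in X$, and there exists $z_1\neq z_2$ such that $\{\delta_{z_1},\delta_{z_2}\}$ are linearly independent in $E'$. (v) All evaluations $\delta_z$, $z\in X$, are linearly independent in $E'$, $\varphi$ has a fixed point $z_0$ such that $z_0$ is an accumulation point of $X$, and $\varphi$ has stable orbits around $z_0$.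
   Context: $C(X)$ is the space of continuous functions $X\to\mathbb{C}$ and $\tau_p$ is the topology of pointwise convergence on $X$. $E'$ is the topological dual of $E$ and $\delta_z\in E'$ is the functional $f\mapsto f(z)$. $\varphi^n$ is the $n$-th iterate of $\varphi$. A point $z$ is periodic for $\varphi$ if $\varphi^n(z)=z$ for some $n\ge 1$. For a fixed point $z_0$ of $\varphi$, $\varphi$ is said to have stable orbits around $z_0$ if there exists a fundamental family $(V_j)_j$ of connected compact neighbourhoods of $z_0$ in $X$ (i.e. a neighbourhood basis at $z_0$) such that $\varphi(V_j)\subseteq V_j$ for every $j\in\mathbb{N}$. An operator $T:E\to E$ is $\tau_p$-supercyclic if there is $f\in E$ such that $\{\lambda T^n f:\lambda\in\mathbb{C},\ n=0,1,2,\dots\}$ is dense in $E$ with respect to the topology induced by $\tau_p$. *)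

theory Defs
  imports "HOL-Analysis.Analysis" "HOL-Library.Function_Algebras"
begin

definition fun_scale :: "complex \<Rightarrow> ('a \<Rightarrow> complex) \<Rightarrow> 'a \<Rightarrow> complex" where
  "fun_scale c f = (\<lambda>x. c * f x)"

text \<open>Addition and zero of functions are the pointwise ones of the theory Function_Algebras.\<close>

global_interpretation fun_space: vector_space "fun_scale :: complex \<Rightarrow> ('a \<Rightarrow> complex) \<Rightarrow> 'a \<Rightarrow> complex"
  by standard (auto simp: fun_scale_def fun_eq_iff algebra_simps)

definition fun_convex :: "('a \<Rightarrow> complex) set \<Rightarrow> bool" where
  "fun_convex V \<longleftrightarrow> (\<forall>f\<in>V. \<forall>g\<in>V. \<forall>u\<ge>0. \<forall>v\<ge>0. u + v = (1::real) \<longrightarrow>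
     fun_scale (of_real u) f + fun_scale (of_real v) g \<in> V)"

text \<open>A locally convex space is a set \<open>E\<close> of functions with an abstract topology \<open>\<tau>\<close> on it; \<open>\<tau>\<close> is
  in general unrelated to the type-class topology of the function type. Hausdorffness of \<open>\<tau>\<close> is not
  required here: it follows from the continuous inclusion in the pointwise topology.\<close>

definition topological_vector_space ::
    "('a \<Rightarrow> complex) set \<Rightarrow> ('a \<Rightarrow> complex) topology \<Rightarrow> bool" where
  "topological_vector_space E \<tau> \<longleftrightarrow>
     topspace \<tau> = E \<and> fun_space.subspace E \<and>
     continuous_map (prod_topology \<tau> \<tau>) \<tau> (\<lambda>(f, g). f + g) \<and>
     continuous_map (prod_topology euclidean \<tau>) \<tau> (\<lambda>(c, f). fun_scale c f)"

definition locally_convex_space ::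
    "('a \<Rightarrow> complex) set \<Rightarrow> ('a \<Rightarrow> complex) topology \<Rightarrow> bool" where
  "locally_convex_space E \<tau> \<longleftrightarrow>
     topological_vector_space E \<tau> \<and>
     (\<forall>U. openin \<tau> U \<and> 0 \<in> U \<longrightarrow>
        (\<exists>W V. openin \<tau> W \<and> 0 \<in> W \<and> W \<subseteq> V \<and> V \<subseteq> U \<and> fun_convex V))"

definition continuous_functions :: "('x::topological_space \<Rightarrow> complex) set" where
  "continuous_functions = {f. continuous_on UNIV f}"

definition pointwise_topology :: "('x::topological_space \<Rightarrow> complex) topology" where
  "pointwise_topology =
     subtopology (product_topology (\<lambda>_. euclidean) UNIV) continuous_functions"

text \<open>The codomain condition of \<^const>\<open>continuous_map\<close> includes
  \<open>E \<subseteq> continuous_functions\<close>.\<close>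

definition continuously_included_pointwise :: "('x::topological_space \<Rightarrow> complex) topology \<Rightarrow> bool" where
  "continuously_included_pointwise \<tau> \<longleftrightarrow> continuous_map \<tau> pointwise_topology (\<lambda>f. f)"

text \<open>Functionals on \<open>E\<close> are represented by functions on the whole function type that vanish
  outside \<open>E\<close>, so that equality and linear combinations are determined on \<open>E\<close>.\<close>

definition topological_dual ::
    "('a \<Rightarrow> complex) set \<Rightarrow> ('a \<Rightarrow> complex) topology \<Rightarrow> (('a \<Rightarrow> complex) \<Rightarrow> complex) set" where
  "topological_dual E \<tau> = {u.
     (\<forall>f\<in>E. \<forall>g\<in>E. u (f + g) = u f + u g) \<and>
     (\<forall>c. \<forall>f\<in>E. u (fun_scale c f) = c * u f) \<and>
     continuous_map \<tau> euclidean u \<and>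
     (\<forall>f. f \<notin> E \<longrightarrow> u f = 0)}"

definition evaluation :: "('a \<Rightarrow> complex) set \<Rightarrow> 'a \<Rightarrow> ('a \<Rightarrow> complex) \<Rightarrow> complex" where
  "evaluation E z = (\<lambda>f. if f \<in> E then f z else 0)"

lemma evaluation_in_dual:
  assumes "locally_convex_space E \<tau>" and "continuously_included_pointwise \<tau>"
  shows "evaluation E z \<in> topological_dual E \<tau>"
proof -
  have E: "topspace \<tau> = E" "fun_space.subspace E"
    using assms(1) by (auto simp: locally_convex_space_def topological_vector_space_def)
  have "continuous_map \<tau> (product_topology (\<lambda>_. euclidean) UNIV) (\<lambda>f. f)"
    using assms(2)
    by (simp add: continuously_included_pointwise_def pointwise_topology_def
        continuous_map_in_subtopology)
  then have "continuous_map \<tau> euclidean (\<lambda>f. f z)"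
    by (simp add: continuous_map_componentwise_UNIV)
  then have "continuous_map \<tau> euclidean (evaluation E z)"
    by (rule continuous_map_eq) (simp add: evaluation_def E)
  then show ?thesis
    using E(2) fun_space.subspace_add[OF E(2)] fun_space.subspace_scale[OF E(2)]
    by (auto simp: topological_dual_def evaluation_def fun_scale_def)
qed

text \<open>Linear independence of the family \<open>(\<delta>\<^sub>z)\<close> indexed by \<open>z \<in> A\<close>; injectivity excludes
  that distinct points with the same evaluation are counted only once.\<close>

definition evaluations_independent :: "('a \<Rightarrow> complex) set \<Rightarrow> 'a set \<Rightarrow> bool" where
  "evaluations_independent E A \<longleftrightarrow>
     inj_on (evaluation E) A \<and> fun_space.independent (evaluation E ` A)"

definition weighted_comp :: "('x \<Rightarrow> complex) \<Rightarrow> ('x \<Rightarrow> 'x) \<Rightarrow> ('x \<Rightarrow> complex) \<Rightarrow> 'x \<Rightarrow> complex" where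
  "weighted_comp w \<phi> f = (\<lambda>x. w x * f (\<phi> x))"

definition pointwise_supercyclic ::
    "('x::topological_space \<Rightarrow> complex) set \<Rightarrow> (('x \<Rightarrow> complex) \<Rightarrow> ('x \<Rightarrow> complex)) \<Rightarrow> bool" where
  "pointwise_supercyclic E A \<longleftrightarrow>
     (\<exists>f\<in>E. subtopology pointwise_topology E closure_of {fun_scale c ((A ^^ n) f) | c n. True} = E)"

definition stable_orbits_around :: "('x::topological_space \<Rightarrow> 'x) \<Rightarrow> 'x \<Rightarrow> bool" where
  "stable_orbits_around \<phi> z0 \<longleftrightarrow>
     (\<exists>V :: nat \<Rightarrow> 'x set.
        (\<forall>j. connected (V j) \<and> compact (V j) \<and> z0 \<in> interior (V j) \<and> \<phi> ` V j \<subseteq> V j) \<and>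
        (\<forall>U. open U \<and> z0 \<in> U \<longrightarrow> (\<exists>j. V j \<subseteq> U)))"

end

theory Submission
  imports Defs
begin

text \<open>Let \<open>f\<close> be a supercyclic vector. If \<open>\<delta>\<^sub>a\<close> and \<open>\<delta>\<^sub>b\<close> are independent, the lines spanned by the
  pairs \<open>(T\<^sup>n f a, T\<^sup>n f b)\<close> are dense in the plane. This fails as soon as \<open>T\<^sup>n f b / T\<^sup>n f a\<close> is
  bounded for all but finitely many \<open>n\<close>, or takes only finitely many values. With
  \<open>T\<^sup>n f x = w x \<cdots> w (\<phi>\<^sup>n\<^sup>-\<^sup>1 x) f (\<phi>\<^sup>n x)\<close> this excludes (i)--(iv) by direct estimates.

  In (v), take a small invariant compact neighbourhood \<open>V\<close> of \<open>z0\<close> on which \<open>f\<close> and \<open>w\<close> have no zeros,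
  and a point \<open>z \<noteq> z0\<close> of \<open>V\<close>. If the orbit of \<open>z\<close> converges to \<open>z0\<close>, then (ii) applies. Otherwise
  stability keeps the orbit closure \<open>K\<close> away from \<open>z0\<close>, and a compactness argument on \<open>K\<close> gives either
  a point at which all products of \<open>\<bar>w / w z0\<bar>\<close> along the orbit are at most 1 or a positive lower
  bound for all of them; each alternative bounds a ratio as above.\<close>

subsection \<open>Iterates\<close>

text \<open>The multiplicative cocycle of \<open>u\<close> over \<open>\<phi>\<close>. The type of
  values is left general because it is used both for the complex weight and for its normalised
  modulus.\<close>

definition orbit_prod :: "('x \<Rightarrow> 'a::comm_monoid_mult) \<Rightarrow> ('x \<Rightarrow> 'x) \<Rightarrow> nat \<Rightarrow> 'x \<Rightarrow> 'a" where
  "orbit_prod u \<phi> n x = (\<Prod>k<n. u ((\<phi> ^^ k) x))"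

lemma orbit_prod_0 [simp]: "orbit_prod u \<phi> 0 x = 1"
  by (simp add: orbit_prod_def)

lemma orbit_prod_Suc: "orbit_prod u \<phi> (Suc n) x = orbit_prod u \<phi> n x * u ((\<phi> ^^ n) x)"
  by (simp add: orbit_prod_def)

lemma orbit_prod_add:
  "orbit_prod u \<phi> (m + n) x = orbit_prod u \<phi> m x * orbit_prod u \<phi> n ((\<phi> ^^ m) x)"
proof (induction n)
  case (Suc n)
  have "(\<phi> ^^ (m + n)) x = (\<phi> ^^ n) ((\<phi> ^^ m) x)"
    by (simp add: add.commute[of m] funpow_add)
  with Suc show ?case
    by (simp add: orbit_prod_Suc mult.assoc)
qed simp

text \<open>Splits off the first factor, where \<open>orbit_prod_Suc\<close> splits off the last;
  together they compare the products at \<open>x\<close> and at \<open>\<phi> x\<close>.\<close>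

lemma orbit_prod_Suc_shift: "orbit_prod u \<phi> (Suc n) x = u x * orbit_prod u \<phi> n (\<phi> x)"
  using orbit_prod_add[of u \<phi> 1 n x] by (simp add: orbit_prod_Suc)

lemma funpow_fixed_point: "\<phi> x = x \<Longrightarrow> (\<phi> ^^ n) x = x"
  by (induction n) auto

lemma orbit_prod_fixed_point: "\<phi> x = x \<Longrightarrow> orbit_prod u \<phi> n x = u x ^ n"
  by (simp add: orbit_prod_def funpow_fixed_point)

lemma orbit_prod_pos:
  fixes u :: "'x \<Rightarrow> real"
  assumes "\<phi> ` K \<subseteq> K" "\<And>x. x \<in> K \<Longrightarrow> u x > 0" "x \<in> K"
  shows "orbit_prod u \<phi> n x > 0"
proof -
  have "(\<phi> ^^ k) x \<in> K" for k
    using assms(1,3) by (induction k) auto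
  then show ?thesis
    using assms(2) by (auto simp: orbit_prod_def intro: prod_pos)
qed

lemma continuous_on_funpow_UNIV:
  fixes \<phi> :: "'x::topological_space \<Rightarrow> 'x"
  shows "continuous_on UNIV \<phi> \<Longrightarrow> continuous_on UNIV (\<phi> ^^ n)"
proof (induction n)
  case 0
  then show ?case
    using continuous_on_id by (simp add: id_def)
next
  case (Suc n)
  then have "continuous_on UNIV (\<phi> \<circ> (\<phi> ^^ n))"
    by (blast intro: continuous_on_compose continuous_on_subset)
  then show ?case
    by simp
qed

lemma continuous_on_orbit_prod:
  fixes u :: "'x::topological_space \<Rightarrow> real"
  assumes "continuous_on UNIV u" "continuous_on UNIV \<phi>"
  shows "continuous_on A (orbit_prod u \<phi> n)"
proof -
  have "continuous_on UNIV (\<lambda>x. u ((\<phi> ^^ k) x))" for k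
    by (rule continuous_on_compose2[OF assms(1) continuous_on_funpow_UNIV[OF assms(2)]]) simp
  then have "continuous_on UNIV (\<lambda>x. \<Prod>k<n. u ((\<phi> ^^ k) x))"
    by (intro continuous_on_prod)
  then show ?thesis
    unfolding orbit_prod_def[abs_def] using continuous_on_subset by blast
qed

lemma weighted_comp_funpow:
  "(weighted_comp w \<phi> ^^ n) f x = orbit_prod w \<phi> n x * f ((\<phi> ^^ n) x)"
proof (induction n arbitrary: x)
  case (Suc n)
  then show ?case
    by (simp add: weighted_comp_def orbit_prod_Suc_shift funpow_swap1 mult.assoc)
qed simp

text \<open>If no orbit in \<open>K\<close> keeps its products below 1, then by compactness a product exceeding 1 occurs
  within a bounded number of steps, and such blocks can be split off.\<close>

lemma orbit_prod_dichotomy: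
  fixes u :: "'x::topological_space \<Rightarrow> real"
  assumes "compact K" and inv: "\<phi> ` K \<subseteq> K"
    and cont: "continuous_on UNIV u" "continuous_on UNIV \<phi>"
    and pos: "\<And>x. x \<in> K \<Longrightarrow> u x > 0"
  shows "(\<exists>y\<in>K. \<forall>n. orbit_prod u \<phi> n y \<le> 1) \<or>
         (\<exists>c>0. \<forall>y\<in>K. \<forall>n. orbit_prod u \<phi> n y \<ge> c)"
proof (rule disjCI)
  assume "\<not> (\<exists>c>0. \<forall>y\<in>K. \<forall>n. orbit_prod u \<phi> n y \<ge> c)"
  then have no_bound: "\<not> (\<forall>y\<in>K. \<forall>n. orbit_prod u \<phi> n y \<ge> c)" if "c > 0" for c
    using that by blast
  show "\<exists>y\<in>K. \<forall>n. orbit_prod u \<phi> n y \<le> 1"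
  proof (rule ccontr)
    assume "\<not> ?thesis"
    then have "\<And>y. y \<in> K \<Longrightarrow> \<exists>n. orbit_prod u \<phi> n y > 1"
      by (meson not_le)
    then have cover: "K \<subseteq> (\<Union>n. {y. orbit_prod u \<phi> n y > 1})"
      by auto
    have "open {y. orbit_prod u \<phi> n y > 1}" for n
      using open_Collect_less[OF continuous_on_const continuous_on_orbit_prod[OF cont, of UNIV n]]
      by simp
    then obtain I where I: "finite I" "K \<subseteq> (\<Union>n\<in>I. {y. orbit_prod u \<phi> n y > 1})"
      by (rule compactE_image[OF \<open>compact K\<close> _ cover])
    \<comment> \<open>\<open>N\<close> bounds the length of a block with product above 1; inserting
      0 keeps \<open>Max\<close> meaningful if \<open>I\<close> is empty.\<close>
    define N where "N = Max (insert 0 I)"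
    have le_N: "n \<le> N" if "n \<in> I" for n
      using I(1) that by (simp add: N_def)
    \<comment> \<open>For fixed \<open>n\<close> the product is continuous and positive on the
      compact set \<open>K\<close>, so its minimum is positive.\<close>
    have "\<exists>c>0. \<forall>y\<in>K. orbit_prod u \<phi> n y \<ge> c" for n
    proof (cases "K = {}")
      case False
      then obtain x where "x \<in> K" "\<forall>y\<in>K. orbit_prod u \<phi> n x \<le> orbit_prod u \<phi> n y"
        using continuous_attains_inf[OF \<open>compact K\<close> _ continuous_on_orbit_prod[OF cont]] by blast
      then show ?thesis
        using orbit_prod_pos[of \<phi> K u x n] inv pos by blast
    qed (auto intro: exI[of _ 1])
    then obtain C where C: "\<And>n. C n > 0" "\<And>n y. y \<in> K \<Longrightarrow> orbit_prod u \<phi> n y \<ge> C n"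
      by metis
    define c where "c = Min (C ` {..N})"
    have "c > 0"
      using C(1) by (simp add: c_def)
    have c_le: "c \<le> C n" if "n \<le> N" for n
      using that by (simp add: c_def)
    \<comment> \<open>For \<open>n > N\<close>, drop an initial block with product above 1 and apply
      induction to the rest. The empty product is 1, so the block is nonempty and the length
      decreases.\<close>
    have "orbit_prod u \<phi> n y \<ge> c" if "y \<in> K" for n y
      using that
    proof (induction n arbitrary: y rule: less_induct)
      case (less n)
      show ?case
      proof (cases "n \<le> N")
        case True
        then show ?thesis
          using C(2)[OF less.prems, of n] c_le[of n] by linarith
      next
        case False
        obtain k where k: "k \<in> I" "orbit_prod u \<phi> k y > 1"
          using I(2) less.prems by blast
        have "k > 0"
          using k(2) by (cases k) auto
        have "k \<le> n"
          using le_N[OF k(1)] False by simp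
        have "(\<phi> ^^ k) y \<in> K" for k
          using inv less.prems by (induction k) auto
        then have "c \<le> orbit_prod u \<phi> (n - k) ((\<phi> ^^ k) y)"
          using less.IH[of "n - k"] \<open>k > 0\<close> \<open>k \<le> n\<close> by auto
        moreover have "1 * orbit_prod u \<phi> (n - k) ((\<phi> ^^ k) y)
            \<le> orbit_prod u \<phi> k y * orbit_prod u \<phi> (n - k) ((\<phi> ^^ k) y)"
          using k(2) \<open>c > 0\<close> calculation by (intro mult_right_mono) auto
        moreover have "\<dots> = orbit_prod u \<phi> n y"
          using orbit_prod_add[of u \<phi> k "n - k" y] \<open>k \<le> n\<close> by simp
        ultimately show ?thesis
          by linarith
      qed
    qed
    then show False
      using no_bound[OF \<open>c > 0\<close>] by blast
  qed
qed

subsection \<open>Independent evaluations\<close>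

lemma independent_not_scale:
  assumes "fun_space.independent {u, v}" "u \<noteq> v"
  shows "u \<noteq> fun_scale c v"
proof
  assume "u = fun_scale c v"
  then have "u \<in> fun_space.span {v}"
    by (auto intro: fun_space.span_scale fun_space.span_base)
  then have "fun_space.dependent {u, v}"
    using assms(2) by (auto simp: fun_space.dependent_def intro!: bexI[of _ u])
  with assms(1) show False
    by simp
qed

lemma evaluations_independent_mono:
  "evaluations_independent E A \<Longrightarrow> B \<subseteq> A \<Longrightarrow> evaluations_independent E B"
  unfolding evaluations_independent_def
  by (meson fun_space.independent_mono image_mono inj_on_subset)

lemma evaluation_nonzero:
  assumes "evaluations_independent E A" "z \<in> A"
  shows "evaluation E z \<noteq> 0"
  using assms fun_space.dependent_zero[of "evaluation E ` A"]
  by (force simp: evaluations_independent_def)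

lemma evaluation_nonzero_iff: "evaluation E z \<noteq> 0 \<longleftrightarrow> (\<exists>g\<in>E. g z \<noteq> 0)"
  by (auto simp: evaluation_def fun_eq_iff)

text \<open>Otherwise every element of \<open>E\<close> vanishing at \<open>b\<close> also vanishes
  at \<open>a\<close>, and \<delta> at \<open>a\<close> is a multiple of \<delta> at
  \<open>b\<close>.\<close>

lemma independent_evaluations_separate:
  assumes E: "fun_space.subspace E" and "evaluations_independent E {a, b}" "a \<noteq> b"
  shows "\<exists>g\<in>E. g a = 1 \<and> g b = 0"
proof (rule ccontr)
  assume none: "\<not> ?thesis"
  obtain h where h: "h \<in> E" "h b \<noteq> 0"
    using evaluation_nonzero[OF assms(2), of b] evaluation_nonzero_iff[of E b] by auto
  have "g a = h a / h b * g b" if "g \<in> E" for g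
  proof (rule ccontr)
    assume neq: "g a \<noteq> h a / h b * g b"
    define d where "d = g a - h a / h b * g b"
    \<comment> \<open>Subtracting a multiple of \<open>h\<close> removes the value at
      \<open>b\<close>; dividing by the remaining value \<open>d\<close> at \<open>a\<close> makes
      the latter 1.\<close>
    define k where "k = fun_scale (1 / d) (g - fun_scale (g b / h b) h)"
    have "k \<in> E"
      unfolding k_def using E h(1) that
      by (intro fun_space.subspace_scale fun_space.subspace_diff) auto
    moreover have "k a = 1" "k b = 0"
      using neq h(2) by (auto simp: k_def d_def fun_scale_def field_simps)
    ultimately show False
      using none by blast
  qed
  then have "evaluation E a = fun_scale (h a / h b) (evaluation E b)"
    by (auto simp: evaluation_def fun_scale_def fun_eq_iff)
  moreover have "fun_space.independent {evaluation E a, evaluation E b}"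
      "evaluation E a \<noteq> evaluation E b"
    using assms(2,3) by (auto simp: evaluations_independent_def inj_on_def)
  ultimately show False
    using independent_not_scale by blast
qed

lemma independent_evaluations_interpolate:
  assumes E: "fun_space.subspace E" and ind: "evaluations_independent E {a, b}" and "a \<noteq> b"
  shows "\<exists>g\<in>E. g a = x \<and> g b = y"
proof -
  obtain g where g: "g \<in> E" "g a = 1" "g b = 0"
    using independent_evaluations_separate[OF assms] by blast
  obtain h where h: "h \<in> E" "h b = 1" "h a = 0"
    using independent_evaluations_separate[OF E, of b a] ind \<open>a \<noteq> b\<close>
    by (auto simp: insert_commute)
  have "fun_scale x g + fun_scale y h \<in> E"
    using E g(1) h(1) by (intro fun_space.subspace_add fun_space.subspace_scale)
  then show ?thesis
    using g h by (intro bexI[of _ "fun_scale x g + fun_scale y h"]) (auto simp: fun_scale_def)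
qed

subsection \<open>Supercyclic vectors\<close>

text \<open>Names the witness in \<open>pointwise_supercyclic\<close>, so that the estimates below
  can refer to one fixed \<open>f\<close>.\<close>

definition supercyclic_vector ::
    "('x::topological_space \<Rightarrow> complex) set \<Rightarrow> (('x \<Rightarrow> complex) \<Rightarrow> 'x \<Rightarrow> complex) \<Rightarrow> ('x \<Rightarrow> complex) \<Rightarrow> bool"
  where
  "supercyclic_vector E A f \<longleftrightarrow> f \<in> E \<and>
     subtopology pointwise_topology E closure_of {fun_scale c ((A ^^ n) f) | c n. True} = E"

text \<open>Evaluation at two points is continuous for pointwise convergence, so a closed set
  containing the image of the dense set of scaled iterates contains the image of
  \<open>E\<close>.\<close>

lemma supercyclic_vector_closed:
  fixes F :: "(complex \<times> complex) set"
  assumes f: "supercyclic_vector E A f" and "closed F"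
    and mem: "\<And>c n. (c * (A ^^ n) f a, c * (A ^^ n) f b) \<in> F" and "g \<in> E"
  shows "(g a, g b) \<in> F"
proof (rule ccontr)
  let ?P = "subtopology pointwise_topology E"
  define S where "S = {fun_scale c ((A ^^ n) f) | c n. True}"
  define U where "U = {h \<in> topspace ?P. (h a, h b) \<in> - F}"
  assume notin: "(g a, g b) \<notin> F"
  have "continuous_map ?P euclidean (\<lambda>h. h z)" for z
    unfolding pointwise_topology_def
    by (intro continuous_map_from_subtopology continuous_map_product_projection) auto
  then have "continuous_map ?P (prod_topology euclidean euclidean) (\<lambda>h. (h a, h b))"
    by (intro continuous_map_pairedI)
  then have "openin ?P U"
    unfolding U_def using \<open>closed F\<close>
    by (intro openin_continuous_map_preimage[of ?P "euclidean :: (complex \<times> complex) topology"])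
      (simp_all add: euclidean_product_topology open_Compl)
  have g: "g \<in> ?P closure_of S"
    using f \<open>g \<in> E\<close> by (simp add: supercyclic_vector_def S_def)
  then have "g \<in> U"
    using notin subsetD[OF closure_of_subset_topspace g] by (simp add: U_def)
  then obtain h where "h \<in> S" "h \<in> U"
    using g \<open>openin ?P U\<close> unfolding in_closure_of by blast
  then show False
    using mem by (auto simp: S_def U_def fun_scale_def)
qed

lemma supercyclic_vector_vanish:
  assumes "supercyclic_vector E A f" "\<And>n. (A ^^ n) f z = 0" "g \<in> E"
  shows "g z = 0"
  using supercyclic_vector_closed[OF assms(1) closed_singleton[of "(0, 0)"], of z z g] assms(2,3)
  by simp

text \<open>The cone of pairs with ratio bounded by \<open>M\<close>, together with finitely many
  lines, is closed and stable under scaling. It cannot contain all pairs of iterates, since the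
  values of \<open>E\<close> at \<open>a\<close> and \<open>b\<close> fill the whole plane.\<close>

lemma supercyclic_vector_ratios:
  assumes E: "fun_space.subspace E" and f: "supercyclic_vector E A f"
    and ab: "evaluations_independent E {a, b}" "a \<noteq> b"
    and R: "finite R" "(0, 0) \<notin> R"
  shows "\<exists>n. cmod ((A ^^ n) f b) > M * cmod ((A ^^ n) f a) \<and>
             (\<forall>(r, s)\<in>R. (A ^^ n) f a * s \<noteq> (A ^^ n) f b * r)"
proof (rule ccontr)
  assume none: "\<not> ?thesis"
  define F where "F = {(x, y). cmod y \<le> M * cmod x} \<union> (\<Union>p\<in>R. {(x, y). x * snd p = y * fst p})"
  have "closed F"
    unfolding F_def case_prod_unfold
    by (intro closed_Un closed_UN R(1) ballI closed_Collect_le closed_Collect_eq continuous_intros)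
  moreover have "(c * (A ^^ n) f a, c * (A ^^ n) f b) \<in> F" for c n
  proof -
    have "cmod ((A ^^ n) f b) \<le> M * cmod ((A ^^ n) f a) \<or>
        (\<exists>p\<in>R. (A ^^ n) f a * snd p = (A ^^ n) f b * fst p)"
      using none by (simp add: case_prod_unfold not_less)
    then show ?thesis
    proof
      assume "cmod ((A ^^ n) f b) \<le> M * cmod ((A ^^ n) f a)"
      then have "cmod c * cmod ((A ^^ n) f b) \<le> cmod c * (M * cmod ((A ^^ n) f a))"
        by (rule mult_left_mono) simp
      then show ?thesis
        by (simp add: F_def norm_mult mult.left_commute)
    next
      assume "\<exists>p\<in>R. (A ^^ n) f a * snd p = (A ^^ n) f b * fst p"
      then have "\<exists>p\<in>R. c * (A ^^ n) f a * snd p = c * (A ^^ n) f b * fst p"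
        by (simp add: mult.assoc) blast
      then show ?thesis
        by (simp add: F_def)
    qed
  qed
  ultimately have F: "(g a, g b) \<in> F" if "g \<in> E" for g
    using supercyclic_vector_closed[OF f] that by blast
  \<comment> \<open>The pair \<open>(1, t)\<close> is to escape \<open>F\<close>: \<open>t\<close>
    exceeds \<open>M\<close> and avoids finitely many slopes. Vertical lines yield the harmless
    slope 0 and never meet first coordinate 1.\<close>
  have "infinite ({max 0 M<..} - (\<lambda>p. Re (snd p / fst p)) ` R)"
    using R(1) by (intro Diff_infinite_finite) (auto simp: infinite_Ioi)
  then obtain t where t: "t > max 0 M" "\<And>p. p \<in> R \<Longrightarrow> t \<noteq> Re (snd p / fst p)"
    by (metis (no_types, lifting) Diff_iff finite.emptyI greaterThan_iff image_eqI ex_in_conv)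
  obtain g where "g \<in> E" "g a = 1" "g b = of_real t"
    using independent_evaluations_interpolate[OF E ab] by blast
  then have "(1, of_real t) \<in> F"
    using F by metis
  moreover have "\<not> cmod (of_real t) \<le> M"
    using t(1) by simp
  ultimately obtain p where p: "p \<in> R" "snd p = of_real t * fst p"
    by (auto simp: F_def)
  have "fst p \<noteq> 0"
    using p R(2) by (metis mult_zero_right prod.collapse)
  then have "Re (snd p / fst p) = t"
    using p(2) by simp
  then show False
    using t(2)[OF p(1)] by simp
qed

text \<open>The finitely many uncontrolled indices contribute only finitely many lines, which
  \<open>supercyclic_vector_ratios\<close> can avoid along with the cone.\<close>

lemma supercyclic_vector_not_dominated:
  assumes E: "fun_space.subspace E" and f: "supercyclic_vector E A f"
    and ab: "evaluations_independent E {a, b}" "a \<noteq> b"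
    and dom: "\<And>n. n \<ge> N \<Longrightarrow> cmod ((A ^^ n) f b) \<le> M * cmod ((A ^^ n) f a)"
  shows False
proof -
  let ?p = "\<lambda>n. ((A ^^ n) f a, (A ^^ n) f b)"
  define M' where "M' = max 0 M"
  obtain n where n: "cmod ((A ^^ n) f b) > M' * cmod ((A ^^ n) f a)"
      "\<forall>(r, s)\<in>?p ` {..<N} - {(0, 0)}. (A ^^ n) f a * s \<noteq> (A ^^ n) f b * r"
    using supercyclic_vector_ratios[OF E f ab, of "?p ` {..<N} - {(0, 0)}" M'] by auto
  show False
  proof (cases "n < N")
    case True
    moreover have "?p n \<noteq> (0, 0)"
      using n(1) by auto
    \<comment> \<open>A nonzero early pair would lie on the very line it spans, and that line was to
      be avoided.\<close>
    ultimately have "?p n \<in> ?p ` {..<N} - {(0, 0)}"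
      by blast
    then show False
      using bspec[OF n(2)] by (fastforce simp: mult.commute)
  next
    case False
    then have "cmod ((A ^^ n) f b) \<le> M * cmod ((A ^^ n) f a)"
      by (intro dom) simp
    also have "\<dots> \<le> M' * cmod ((A ^^ n) f a)"
      by (intro mult_right_mono) (auto simp: M'_def)
    finally show False
      using n(1) by simp
  qed
qed

subsection \<open>Weighted composition operators\<close>

text \<open>A zero of \<open>f\<close> at a fixed point is a zero of all iterates, hence by density
  of all of \<open>E\<close>.\<close>

lemma supercyclic_vector_fixed_point:
  assumes f: "supercyclic_vector E (weighted_comp w \<phi>) f"
    and "\<phi> z = z" "evaluation E z \<noteq> 0"
  shows "f z \<noteq> 0"
proof
  assume "f z = 0"
  then have "(weighted_comp w \<phi> ^^ n) f z = 0" for n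
    using assms(2) by (simp add: weighted_comp_funpow funpow_fixed_point)
  then show False
    using supercyclic_vector_vanish[OF f] assms(3) unfolding evaluation_nonzero_iff by metis
qed

text \<open>If \<open>w a = 0\<close>, every iterate except the zeroth vanishes at \<open>a\<close>
  and is trivially dominated by its value at \<open>b\<close>.\<close>

lemma supercyclic_vector_weight_nonzero:
  assumes E: "fun_space.subspace E" and f: "supercyclic_vector E (weighted_comp w \<phi>) f"
    and ab: "evaluations_independent E {a, b}" "a \<noteq> b"
  shows "w a \<noteq> 0"
proof
  assume "w a = 0"
  have "orbit_prod w \<phi> n a = 0" if "n \<ge> 1" for n
    using that \<open>w a = 0\<close> by (cases n) (auto simp: orbit_prod_Suc_shift)
  then have "cmod ((weighted_comp w \<phi> ^^ n) f a) \<le> 0 * cmod ((weighted_comp w \<phi> ^^ n) f b)"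
    if "n \<ge> 1" for n
    using that by (simp add: weighted_comp_funpow)
  then show False
    using supercyclic_vector_not_dominated[OF E f, of b a 1 0] ab by (auto simp: insert_commute)
qed

section \<open>Fixed, convergent and periodic orbits\<close>

text \<open>At a fixed point the iterates are powers of the weight times the value of
  \<open>f\<close>, so the point with the larger weight dominates.\<close>

lemma two_fixed_points:
  assumes E: "fun_space.subspace E" and f: "supercyclic_vector E (weighted_comp w \<phi>) f"
    and ab: "evaluations_independent E {a, b}" "a \<noteq> b"
    and fixed: "\<phi> a = a" "\<phi> b = b" and le: "cmod (w b) \<le> cmod (w a)"
  shows False
proof -
  have "f a \<noteq> 0"
    using supercyclic_vector_fixed_point[OF f fixed(1)] evaluation_nonzero[OF ab(1)] by simp
  have "cmod ((weighted_comp w \<phi> ^^ n) f b)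
      \<le> cmod (f b) / cmod (f a) * cmod ((weighted_comp w \<phi> ^^ n) f a)" for n
    using fixed \<open>f a \<noteq> 0\<close> power_mono[OF le, of n]
    by (simp add: weighted_comp_funpow orbit_prod_fixed_point funpow_fixed_point norm_mult norm_power
        mult.commute mult_left_mono)
  then show False
    using supercyclic_vector_not_dominated[OF E f ab] by blast
qed

text \<open>In the ratio of the iterates at \<open>\<phi> z1\<close> and \<open>z1\<close> all but
  the end factors cancel. What is left converges along the orbit, hence is bounded.\<close>

lemma convergent_orbit:
  fixes \<phi> :: "'x::t2_space \<Rightarrow> 'x"
  assumes E: "fun_space.subspace E" "E \<subseteq> continuous_functions"
    and f: "supercyclic_vector E (weighted_comp w \<phi>) f"
    and cont: "continuous_on UNIV w" "continuous_on UNIV \<phi>"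
    and lim: "(\<lambda>n. (\<phi> ^^ n) z1) \<longlonglongrightarrow> z0" and "evaluation E z0 \<noteq> 0"
    and ind: "evaluations_independent E {z1, \<phi> z1}" "\<phi> z1 \<noteq> z1"
  shows False
proof -
  let ?x = "\<lambda>n. (\<phi> ^^ n) z1"
  let ?T = "\<lambda>n. (weighted_comp w \<phi> ^^ n) f"
  have lim_comp: "(\<lambda>n. h (?x n)) \<longlonglongrightarrow> h z0" if "continuous_on UNIV h"
    for h :: "'x \<Rightarrow> 'b::topological_space"
    using continuous_on_tendsto_compose[OF that lim] by simp
  have lim_Suc: "(\<lambda>n. ?x (Suc n)) \<longlonglongrightarrow> z0"
    using lim by (rule LIMSEQ_Suc)
  have "\<phi> z0 = z0"
    using LIMSEQ_unique[OF lim_comp[OF cont(2)]] lim_Suc by simp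
  then have "f z0 \<noteq> 0"
    using supercyclic_vector_fixed_point[OF f] assms(7) by blast
  have "w z1 \<noteq> 0"
    using supercyclic_vector_weight_nonzero[OF E(1) f ind(1)] ind(2) by simp
  have f_cont: "continuous_on UNIV f"
    using E(2) f by (auto simp: continuous_functions_def supercyclic_vector_def)
  \<comment> \<open>The ratio after cancellation. It is the true ratio only where
    \<open>f (?x n)\<close> is nonzero, which holds for large \<open>n\<close> because
    \<open>f z0 \<noteq> 0\<close>.\<close>
  define q where "q n = w (?x n) * f (?x (Suc n)) / (w z1 * f (?x n))" for n
  have "q \<longlonglongrightarrow> w z0 * f z0 / (w z1 * f z0)"
    unfolding q_def using \<open>f z0 \<noteq> 0\<close> \<open>w z1 \<noteq> 0\<close>
    by (intro tendsto_intros lim_comp cont(1) f_cont LIMSEQ_Suc[OF lim_comp[OF f_cont]]) auto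
  then have "Bseq q"
    using convergentI convergent_imp_Bseq by blast
  then obtain M where M: "\<And>n. cmod (q n) \<le> M"
    unfolding Bseq_def by blast
  have "eventually (\<lambda>n. f (?x n) \<noteq> 0) sequentially"
    using tendsto_imp_eventually_ne[OF lim_comp[OF f_cont] \<open>f z0 \<noteq> 0\<close>] .
  then obtain N where N: "\<And>n. n \<ge> N \<Longrightarrow> f (?x n) \<noteq> 0"
    unfolding eventually_sequentially by blast
  have "cmod (?T n (\<phi> z1)) \<le> M * cmod (?T n z1)" if "n \<ge> N" for n
  proof -
    have "w z1 * orbit_prod w \<phi> n (\<phi> z1) = orbit_prod w \<phi> n z1 * w (?x n)"
      using orbit_prod_Suc_shift[of w \<phi> n z1] orbit_prod_Suc[of w \<phi> n z1] by simp
    then have "orbit_prod w \<phi> n (\<phi> z1) = orbit_prod w \<phi> n z1 * w (?x n) / w z1"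
      using \<open>w z1 \<noteq> 0\<close> by (simp add: field_simps)
    then have "?T n (\<phi> z1) = q n * ?T n z1"
      using N[OF that] \<open>w z1 \<noteq> 0\<close>
      by (simp add: weighted_comp_funpow q_def funpow_swap1)
    then show ?thesis
      using M[of n] by (simp add: norm_mult mult_right_mono)
  qed
  then show False
    using supercyclic_vector_not_dominated[OF E(1) f ind(1)] ind(2) by metis
qed

text \<open>The product over a full period is the same from \<open>z\<close> and from
  \<open>\<phi> z\<close>, so a period multiplies both values by one scalar and the pairs lie on at
  most \<open>p\<close> lines.\<close>

lemma periodic_orbit:
  assumes E: "fun_space.subspace E" and f: "supercyclic_vector E (weighted_comp w \<phi>) f"
    and per: "p \<ge> 1" "(\<phi> ^^ p) z = z"
    and ind: "evaluations_independent E {z, \<phi> z}" "\<phi> z \<noteq> z"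
  shows False
proof -
  let ?T = "\<lambda>n. (weighted_comp w \<phi> ^^ n) f"
  let ?p = "\<lambda>n. (?T n z, ?T n (\<phi> z))"
  define W where "W = orbit_prod w \<phi> p z"
  have per': "(\<phi> ^^ p) (\<phi> z) = \<phi> z"
    using per(2) by (metis funpow_swap1)
  obtain m where "p = Suc m"
    using per(1) by (cases p) auto
  \<comment> \<open>Starting one step later only moves the factor \<open>w z\<close> from the front
    to the end.\<close>
  then have W': "orbit_prod w \<phi> p (\<phi> z) = W"
    using orbit_prod_Suc[of w \<phi> m "\<phi> z"] orbit_prod_Suc_shift[of w \<phi> m z] per(2)
    by (simp add: W_def funpow_swap1 mult.commute)
  have step: "?T (p + n) z = W * ?T n z \<and> ?T (p + n) (\<phi> z) = W * ?T n (\<phi> z)" for n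
  proof -
    have "(\<phi> ^^ (p + n)) x = (\<phi> ^^ n) ((\<phi> ^^ p) x)" for x
      by (simp add: add.commute[of p] funpow_add)
    then show ?thesis
      using per(2) per' W' by (simp add: weighted_comp_funpow orbit_prod_add W_def mult.assoc)
  qed
  have ratio: "\<exists>r<p. \<exists>c. ?T n z = c * ?T r z \<and> ?T n (\<phi> z) = c * ?T r (\<phi> z)" for n
  proof (induction n rule: less_induct)
    case (less n)
    show ?case
    proof (cases "n < p")
      case True
      then show ?thesis
        by (intro exI[of _ n] conjI exI[of _ 1]) auto
    next
      case False
      then obtain r c where "r < p" "?T (n - p) z = c * ?T r z" "?T (n - p) (\<phi> z) = c * ?T r (\<phi> z)"
        using less.IH[of "n - p"] per(1) by auto
      then show ?thesis
        using step[of "n - p"] False by (intro exI[of _ r] conjI exI[of _ "W * c"]) auto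
    qed
  qed
  \<comment> \<open>With bound 0 the cone condition just says that the value at
    \<open>\<phi> z\<close> is nonzero; hence the pair of index \<open>r\<close> found next is
    nonzero too.\<close>
  obtain n where n: "cmod (?T n (\<phi> z)) > 0 * cmod (?T n z)"
      "\<forall>(r, s)\<in>?p ` {..<p} - {(0, 0)}. ?T n z * s \<noteq> ?T n (\<phi> z) * r"
    using supercyclic_vector_ratios[OF E f ind(1) ind(2)[symmetric],
        of "?p ` {..<p} - {(0, 0)}" 0] by auto
  obtain r c where r: "r < p" "?T n z = c * ?T r z" "?T n (\<phi> z) = c * ?T r (\<phi> z)"
    using ratio by blast
  have "?p r \<in> ?p ` {..<p} - {(0, 0)}"
    using r n(1) by auto
  then have "?T n z * ?T r (\<phi> z) \<noteq> ?T n (\<phi> z) * ?T r z"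
    using n(2) by blast
  then show False
    using r(2,3) by simp
qed

text \<open>The bound is put on the products rather than on \<open>w\<close>, so that it serves both
  a globally maximal weight and a single well-chosen orbit.\<close>

lemma dominated_by_fixed_point:
  assumes E: "fun_space.subspace E" and f: "supercyclic_vector E (weighted_comp w \<phi>) f"
    and ind: "evaluations_independent E {z0, y}" "z0 \<noteq> y" and "\<phi> z0 = z0"
    and w: "\<And>n. cmod (orbit_prod w \<phi> n y) \<le> cmod (w z0) ^ n"
    and B: "\<And>n. cmod (f ((\<phi> ^^ n) y)) \<le> B"
  shows False
proof -
  have "f z0 \<noteq> 0"
    using supercyclic_vector_fixed_point[OF f \<open>\<phi> z0 = z0\<close>] evaluation_nonzero[OF ind(1)] by simp
  have "cmod ((weighted_comp w \<phi> ^^ n) f y)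
      \<le> B / cmod (f z0) * cmod ((weighted_comp w \<phi> ^^ n) f z0)" for n
    using mult_mono[OF w B] \<open>\<phi> z0 = z0\<close> \<open>f z0 \<noteq> 0\<close>
    by (simp add: weighted_comp_funpow orbit_prod_fixed_point funpow_fixed_point norm_mult norm_power
        mult.commute)
  then show False
    using supercyclic_vector_not_dominated[OF E f ind] by blast
qed

section \<open>Fixed points with stable orbits\<close>

lemma cmod_orbit_prod_scaled:
  assumes "c \<noteq> 0"
  shows "cmod (orbit_prod w \<phi> n y) = orbit_prod (\<lambda>x. cmod (w x) / cmod c) \<phi> n y * cmod c ^ n"
  using assms by (simp add: orbit_prod_def prod_dividef prod_norm)

text \<open>An orbit that enters an invariant \<open>V j\<close> stays there. Without convergence it
  therefore never enters some \<open>V j\<close>, and its closure misses the interior.\<close>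

lemma nonconvergent_stable_orbit_closure:
  assumes V: "\<And>j. z0 \<in> interior (V j)" "\<And>j. \<phi> ` V j \<subseteq> V j"
    and basis: "\<And>U. open U \<Longrightarrow> z0 \<in> U \<Longrightarrow> \<exists>j. V j \<subseteq> U"
    and "\<not> (\<lambda>n. (\<phi> ^^ n) z) \<longlonglongrightarrow> z0"
  shows "z0 \<notin> closure (range (\<lambda>n. (\<phi> ^^ n) z))"
proof -
  obtain U where U: "open U" "z0 \<in> U" "\<not> eventually (\<lambda>n. (\<phi> ^^ n) z \<in> U) sequentially"
    using assms(4) unfolding tendsto_def by auto
  obtain j where j: "V j \<subseteq> U"
    using basis[OF U(1,2)] by blast
  have "(\<phi> ^^ m) z \<notin> V j" for m
  proof
    assume enter: "(\<phi> ^^ m) z \<in> V j"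
    have "(\<phi> ^^ n) z \<in> V j" if "n \<ge> m" for n
      using that by (induction n rule: dec_induct) (use enter V(2)[of j] in auto)
    then show False
      using U(3) j unfolding eventually_sequentially by blast
  qed
  then have "range (\<lambda>n. (\<phi> ^^ n) z) \<inter> interior (V j) = {}"
    using interior_subset by fastforce
  then have "closure (range (\<lambda>n. (\<phi> ^^ n) z)) \<inter> interior (V j) = {}"
    using open_Int_closure_eq_empty[of "interior (V j)"] by (metis Int_commute open_interior)
  then show ?thesis
    using V(1) by blast
qed

lemma stable_fixed_point:
  fixes \<phi> :: "'x::t2_space \<Rightarrow> 'x"
  assumes E: "fun_space.subspace E" "E \<subseteq> continuous_functions"
    and f: "supercyclic_vector E (weighted_comp w \<phi>) f"
    and cont: "continuous_on UNIV w" "continuous_on UNIV \<phi>"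
    and ind: "evaluations_independent E UNIV"
    and "\<phi> z0 = z0" "z0 islimpt UNIV" "stable_orbits_around \<phi> z0"
  shows False
proof -
  let ?T = "\<lambda>n. (weighted_comp w \<phi> ^^ n) f"
  have pair: "evaluations_independent E {x, y}" for x y
    by (rule evaluations_independent_mono[OF ind]) simp
  obtain V :: "nat \<Rightarrow> 'x set" where V: "\<And>j. compact (V j)" "\<And>j. z0 \<in> interior (V j)" "\<And>j. \<phi> ` V j \<subseteq> V j"
    and basis: "\<And>U. open U \<Longrightarrow> z0 \<in> U \<Longrightarrow> \<exists>j. V j \<subseteq> U"
    using assms(9) unfolding stable_orbits_around_def by metis
  have other: "\<exists>z\<in>V j. z \<noteq> z0" for j
    using islimptE[OF assms(8) V(2)[of j] open_interior] interior_subset by blast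
  have "f z0 \<noteq> 0"
    using supercyclic_vector_fixed_point[OF f \<open>\<phi> z0 = z0\<close>] evaluation_nonzero[OF ind] by simp
  have "w z0 \<noteq> 0"
    using supercyclic_vector_weight_nonzero[OF E(1) f pair] other by metis
  have f_cont: "continuous_on UNIV f"
    using E(2) f by (auto simp: continuous_functions_def supercyclic_vector_def)
  have "open {x. f x \<noteq> 0 \<and> w x \<noteq> 0}"
    by (intro open_Collect_conj open_Collect_neq f_cont cont(1) continuous_on_const)
  then obtain j where j: "V j \<subseteq> {x. f x \<noteq> 0 \<and> w x \<noteq> 0}"
    using basis \<open>f z0 \<noteq> 0\<close> \<open>w z0 \<noteq> 0\<close> by blast
  obtain z where z: "z \<in> V j" "z \<noteq> z0"
    using other by blast
  have not_conv: "\<not> (\<lambda>n. (\<phi> ^^ n) z) \<longlonglongrightarrow> z0"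
  proof
    assume lim: "(\<lambda>n. (\<phi> ^^ n) z) \<longlonglongrightarrow> z0"
    have "\<phi> z \<noteq> z"
    proof
      assume "\<phi> z = z"
      then have "(\<lambda>n. z) \<longlonglongrightarrow> z0"
        using lim by (simp add: funpow_fixed_point)
      then show False
        using z(2) LIMSEQ_unique[OF tendsto_const] by blast
    qed
    then show False
      using convergent_orbit[OF E f cont lim evaluation_nonzero[OF ind] pair] by simp
  qed
  define K where "K = closure (range (\<lambda>n. (\<phi> ^^ n) z))"
  have "z0 \<notin> K"
    unfolding K_def by (rule nonconvergent_stable_orbit_closure[OF V(2,3) basis not_conv])
  have "z \<in> K"
    unfolding K_def by (rule closure_subset[THEN subsetD]) (auto intro: range_eqI[of _ _ 0])
  have "(\<phi> ^^ n) z \<in> V j" for n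
    using z(1) V(3)[of j] by (induction n) auto
  then have KV: "K \<subseteq> V j"
    unfolding K_def by (intro closure_minimal) (auto intro: compact_imp_closed V(1))
  have "compact K"
    using KV compact_Int_closed[OF V(1)[of j], of K] by (simp add: K_def Int_absorb1)
  have K_inv: "\<phi> ` K \<subseteq> K"
  proof -
    have "\<phi> ` range (\<lambda>n. (\<phi> ^^ n) z) \<subseteq> K"
      unfolding K_def by (rule order_trans[OF _ closure_subset]) (auto intro: range_eqI[of _ _ "Suc _"])
    then show ?thesis
      unfolding K_def
      by (intro image_closure_subset continuous_on_subset[OF cont(2)]) auto
  qed
  then have K_orbit: "(\<phi> ^^ n) y \<in> K" if "y \<in> K" for n y
    using that by (induction n) auto
  have f_cont_K: "continuous_on K (\<lambda>x. cmod (f x))"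
    by (intro continuous_on_norm continuous_on_subset[OF f_cont]) auto
  \<comment> \<open>The maximum of \<bar>f\<bar> on \<open>K\<close> serves the first alternative
    below, its positive minimum the second.\<close>
  obtain y1 where y1: "\<And>x. x \<in> K \<Longrightarrow> cmod (f x) \<le> cmod (f y1)"
    using continuous_attains_sup[OF \<open>compact K\<close> _ f_cont_K] \<open>z \<in> K\<close> by blast
  obtain y2 where y2: "y2 \<in> K" "\<And>x. x \<in> K \<Longrightarrow> cmod (f y2) \<le> cmod (f x)"
    using continuous_attains_inf[OF \<open>compact K\<close> _ f_cont_K] \<open>z \<in> K\<close> by blast
  have "f y2 \<noteq> 0"
    using y2(1) KV j by blast
  \<comment> \<open>Dividing by the weight at \<open>z0\<close> turns comparison with the iterates
    at \<open>z0\<close> into comparison of products with constants.\<close>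
  define u where "u = (\<lambda>x. cmod (w x) / cmod (w z0))"
  have scaled: "cmod (orbit_prod w \<phi> n y) = orbit_prod u \<phi> n y * cmod (w z0) ^ n" for n y
    unfolding u_def by (rule cmod_orbit_prod_scaled[OF \<open>w z0 \<noteq> 0\<close>])
  have "continuous_on UNIV u"
    unfolding u_def using \<open>w z0 \<noteq> 0\<close> by (intro continuous_intros cont(1)) auto
  moreover have "u x > 0" if "x \<in> K" for x
    using that KV j \<open>w z0 \<noteq> 0\<close> by (auto simp: u_def)
  ultimately have "(\<exists>y\<in>K. \<forall>n. orbit_prod u \<phi> n y \<le> 1) \<or>
      (\<exists>c>0. \<forall>y\<in>K. \<forall>n. orbit_prod u \<phi> n y \<ge> c)"
    by (intro orbit_prod_dichotomy \<open>compact K\<close> K_inv cont(2))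
  then consider y where "y \<in> K" "\<And>n. orbit_prod u \<phi> n y \<le> 1"
    | c where "c > 0" "\<And>n. orbit_prod u \<phi> n z \<ge> c"
    using \<open>z \<in> K\<close> by blast
  then show False
  proof cases
    \<comment> \<open>Here the fixed point \<open>z0\<close> dominates \<open>y\<close>.\<close>
    case 1
    have "cmod (orbit_prod w \<phi> n y) \<le> cmod (w z0) ^ n" for n
      using 1(2)[of n] by (simp add: scaled mult_left_le_one_le mult.commute mult_left_le)
    moreover have "z0 \<noteq> y"
      using 1(1) \<open>z0 \<notin> K\<close> by blast
    ultimately show False
      using dominated_by_fixed_point[OF E(1) f pair _ \<open>\<phi> z0 = z0\<close>] K_orbit[OF 1(1)] y1 by metis
  next
    \<comment> \<open>Here the roles are reversed: the values at \<open>z\<close> dominate those at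
      \<open>z0\<close>.\<close>
    case 2
    define m where "m = c * cmod (f y2)"
    have "m > 0"
      using 2(1) \<open>f y2 \<noteq> 0\<close> by (simp add: m_def)
    have "cmod (?T n z0) \<le> cmod (f z0) / m * cmod (?T n z)" for n
    proof -
      have "m \<le> orbit_prod u \<phi> n z * cmod (f ((\<phi> ^^ n) z))"
        unfolding m_def
        using 2(1) 2(2)[of n] y2(2)[OF K_orbit[OF \<open>z \<in> K\<close>]] by (intro mult_mono) auto
      then have "m * cmod (w z0) ^ n \<le> cmod (?T n z)"
        using mult_right_mono[of m "orbit_prod u \<phi> n z * cmod (f ((\<phi> ^^ n) z))" "cmod (w z0) ^ n"]
        by (simp add: weighted_comp_funpow norm_mult scaled ac_simps)
      then have "cmod (f z0) / m * (m * cmod (w z0) ^ n) \<le> cmod (f z0) / m * cmod (?T n z)"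
        using \<open>m > 0\<close> by (intro mult_left_mono) auto
      then show ?thesis
        using \<open>m > 0\<close> \<open>\<phi> z0 = z0\<close>
        by (simp add: weighted_comp_funpow orbit_prod_fixed_point funpow_fixed_point norm_mult
            norm_power mult.commute)
    qed
    then show False
      using supercyclic_vector_not_dominated[OF E(1) f pair z(2)] by blast
  qed
qed

theorem theorem8:
  fixes E :: "('x::t2_space \<Rightarrow> complex) set"
    and \<tau> :: "('x \<Rightarrow> complex) topology"
    and w :: "'x \<Rightarrow> complex" and \<phi> :: "'x \<Rightarrow> 'x"
  assumes "locally_convex_space E \<tau>"
    and "continuously_included_pointwise \<tau>"
    and "continuous_on UNIV w" and "continuous_on UNIV \<phi>"
    and "\<forall>f\<in>E. weighted_comp w \<phi> f \<in> E"
    and "continuous_map \<tau> \<tau> (weighted_comp w \<phi>)"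
    and "(\<exists>z1 z2. z1 \<noteq> z2 \<and> \<phi> z1 = z1 \<and> \<phi> z2 = z2 \<and> evaluations_independent E {z1, z2})
       \<or> (\<exists>z1 z0. \<not> (\<lambda>n. (\<phi> ^^ n) z1) constant_on UNIV \<and>
            (\<lambda>n. (\<phi> ^^ n) z1) \<longlonglongrightarrow> z0 \<and> evaluation E z0 \<noteq> 0 \<and>
            evaluations_independent E {z1, \<phi> z1})
       \<or> (compact (UNIV :: 'x set) \<and>
            (\<exists>z1. (\<exists>n\<ge>1. (\<phi> ^^ n) z1 = z1) \<and> \<phi> z1 \<noteq> z1 \<and> evaluations_independent E {z1, \<phi> z1}))
       \<or> (compact (UNIV :: 'x set) \<and>
            (\<exists>z2. \<phi> z2 = z2 \<and> (\<forall>z. cmod (w z) \<le> cmod (w z2)) \<and>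
               (\<exists>z1. z1 \<noteq> z2 \<and> evaluations_independent E {z1, z2})))
       \<or> (evaluations_independent E UNIV \<and>
            (\<exists>z0. \<phi> z0 = z0 \<and> z0 islimpt UNIV \<and> stable_orbits_around \<phi> z0))"
  shows "\<not> pointwise_supercyclic E (weighted_comp w \<phi>)"
proof
  assume "pointwise_supercyclic E (weighted_comp w \<phi>)"
  then obtain f where f: "supercyclic_vector E (weighted_comp w \<phi>) f"
    unfolding pointwise_supercyclic_def supercyclic_vector_def by blast
  have E: "fun_space.subspace E" "topspace \<tau> = E"
    using assms(1) by (auto simp: locally_convex_space_def topological_vector_space_def)
  have E_cont: "E \<subseteq> continuous_functions"
    using assms(2) E(2)
    by (auto simp: continuously_included_pointwise_def pointwise_topology_def
        continuous_map_in_subtopology)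
  have f_cont: "continuous_on UNIV f"
    using E_cont f by (auto simp: continuous_functions_def supercyclic_vector_def)
  show False
    using assms(7)
  proof (elim disjE exE conjE)
    fix z1 z2
    assume "z1 \<noteq> z2" "\<phi> z1 = z1" "\<phi> z2 = z2" "evaluations_independent E {z1, z2}"
    then show False
      using two_fixed_points[OF E(1) f, of z1 z2] two_fixed_points[OF E(1) f, of z2 z1]
      by (metis insert_commute linear)
  next
    fix z1 z0
    assume nonconst: "\<not> (\<lambda>n. (\<phi> ^^ n) z1) constant_on UNIV"
      and orbit: "(\<lambda>n. (\<phi> ^^ n) z1) \<longlonglongrightarrow> z0" "evaluation E z0 \<noteq> 0"
        "evaluations_independent E {z1, \<phi> z1}"
    have "\<phi> z1 \<noteq> z1"
      using nonconst funpow_fixed_point[of \<phi> z1] unfolding constant_on_def by blast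
    then show False
      using convergent_orbit[OF E(1) E_cont f assms(3,4)] orbit by blast
  next
    fix z1 n
    assume "1 \<le> n" "(\<phi> ^^ n) z1 = z1" "\<phi> z1 \<noteq> z1" "evaluations_independent E {z1, \<phi> z1}"
    then show False
      using periodic_orbit[OF E(1) f] by blast
  next
    fix z2 z1
    assume "compact (UNIV :: 'x set)" and z2: "\<phi> z2 = z2" "\<forall>z. cmod (w z) \<le> cmod (w z2)"
      and z1: "z1 \<noteq> z2" "evaluations_independent E {z1, z2}"
    have "continuous_on UNIV (\<lambda>x. cmod (f x))"
      by (intro continuous_on_norm f_cont)
    then obtain y where "\<And>x. cmod (f x) \<le> cmod (f y)"
      using continuous_attains_sup[OF \<open>compact UNIV\<close>] by blast
    \<comment> \<open>Each factor along the orbit is at most the maximal weight, attained at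
      \<open>z2\<close>.\<close>
    moreover have "cmod (orbit_prod w \<phi> n z1) \<le> cmod (w z2) ^ n" for n
      using prod_mono[of "{..<n}" "\<lambda>k. cmod (w ((\<phi> ^^ k) z1))" "\<lambda>_. cmod (w z2)"] z2(2)
      by (simp add: orbit_prod_def prod_norm)
    ultimately show False
      using dominated_by_fixed_point[OF E(1) f, of z2 z1] z1 z2(1) by (metis insert_commute)
  next
    fix z0
    assume "evaluations_independent E UNIV" "\<phi> z0 = z0" "z0 islimpt UNIV"
      "stable_orbits_around \<phi> z0"
    then show False
      by (rule stable_fixed_point[OF E(1) E_cont f assms(3,4)])
  qed
qed

end
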